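(* Let $f_1,f_2\in C^2(\mathbb{R})$ and suppose that there are constants $C_1,C_2>0$ and exponents $\mu_1,\mu_2>1$ such that for $i=1,2$ $$0<f_i''(t)\le C_i(1+t^2)^{-\mu_i/2}\quad\text{for all } t\in\mathbb{R}.$$ Let $f(p_1,p_2):=f_1(p_1)+f_2(p_2)$ for $(p_1,p_2)\in\mathbb{R}^2$, and let $u\in C^2(\mathbb{R}^2)$ be a solution of $$\operatorname{div}\big(Df(\nabla u)\big)=0\quad\text{on } \mathbb{R}^2 .$$ Let $\kappa_1>0$ and $0\le\kappa_2<1$ be real numbers with $$\mu_1>1+\frac{1}{\kappa_1}\,\frac{\kappa_2}{1-\kappa_2},$$ and let $\rho$ be a real number (which exists by the preceding inequality) with $$\frac{\kappa_2}{1-\kappa_2}<\rho<\kappa_1(\mu_1-1).$$ Set $$M_{1,\rho}:=\{(x_1,x_2)\in\mathbb{R}^2: |x_2|\le 2|x_1|^{1+\rho}\},\qquad M_{2,\rho}:=\{(x_1,x_2)\in\mathbb{R}^2: |x_1|\le 2|x_2|^{1/(1+\rho)}\}.$$ Suppose that for some constant $k>0$ $$\limsup_{\substack{|x_2|\to\infty\\ (x_1,x_2)\in M_{2,\rho}}}\frac{|\partial_1u(x_1,x_2)|}{|x_2|^{\kappa_2}}\le k .$$ Then $$\liminf_{\substack{|x_1|\to\infty\\ (x_1,x_2)\in M_{1,\rho}}}\frac{|\partial_1u(x_1,x_2)|}{|x_1|^{\kappa_1}}=0 .$$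
   Context: The equation $\operatorname{div}(Df(\nabla u))=0$ reads $f_1''(\partial_1u)\,\partial_{11}u+f_2''(\partial_2u)\,\partial_{22}u=0$. The limits are taken over the indicated planar sets: the $\limsup$ is $\lim_{T\to\infty}\sup\{|\partial_1u(x)|/|x_2|^{\kappa_2}: x=(x_1,x_2)\in M_{2,\rho},\ |x_2|\ge T\}$, and the $\liminf$ is $\lim_{T\to\infty}\inf\{|\partial_1u(x)|/|x_1|^{\kappa_1}: x=(x_1,x_2)\in M_{1,\rho},\ |x_1|\ge T\}$. *)

theory Defs
  imports "HOL-Analysis.Analysis" "HOL-Library.Going_To_Filter"
begin

definition C2_real :: "(real \<Rightarrow> real) \<Rightarrow> bool" where
  "C2_real g \<longleftrightarrow>
     (\<forall>t. g differentiable (at t)) \<and>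
     (\<forall>t. deriv g differentiable (at t)) \<and>
     continuous_on UNIV (deriv (deriv g))"

definition partial :: "'n::finite \<Rightarrow> (real ^ 'n \<Rightarrow> real) \<Rightarrow> real ^ 'n \<Rightarrow> real" where
  "partial i u x = deriv (\<lambda>t. u (x + t *\<^sub>R axis i 1)) 0"

definition has_partials :: "(real ^ 'n::finite \<Rightarrow> real) \<Rightarrow> bool" where
  "has_partials u \<longleftrightarrow> (\<forall>i x. (\<lambda>t. u (x + t *\<^sub>R axis i 1)) differentiable (at 0))"

text \<open>All partial derivatives of order one and two exist on the whole space and are continuous;
  continuity of \<open>u\<close> itself then follows.\<close>

definition C2_space :: "(real ^ 'n::finite \<Rightarrow> real) \<Rightarrow> bool" where
  "C2_space u \<longleftrightarrow>
     has_partials u \<and> (\<forall>i. continuous_on UNIV (partial i u)) \<and>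
     (\<forall>i. has_partials (partial i u)) \<and>
     (\<forall>i j. continuous_on UNIV (partial j (partial i u)))"

definition grad :: "(real ^ 'n::finite \<Rightarrow> real) \<Rightarrow> real ^ 'n \<Rightarrow> real ^ 'n" where
  "grad u x = (\<chi> i. partial i u x)"

definition divergence :: "(real ^ 'n::finite \<Rightarrow> real ^ 'n) \<Rightarrow> real ^ 'n \<Rightarrow> real" where
  "divergence V x = (\<Sum>i\<in>UNIV. partial i (\<lambda>y. V y $ i) x)"

definition M1 :: "real \<Rightarrow> (real ^ 2) set" where
  "M1 \<rho> = {x. \<bar>x $ 2\<bar> \<le> 2 * \<bar>x $ 1\<bar> powr (1 + \<rho>)}"

definition M2 :: "real \<Rightarrow> (real ^ 2) set" where
  "M2 \<rho> = {x. \<bar>x $ 1\<bar> \<le> 2 * \<bar>x $ 2\<bar> powr (1 / (1 + \<rho>))}"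

end

theory Submission
  imports Defs
begin

text \<open>Write \<open>w = \<partial>\<^sub>1u\<close> and \<open>v = \<partial>\<^sub>2u\<close>. The equation makes the differentiated flux
  \<open>(f\<^sub>1''(w) \<partial>\<^sub>1w, f\<^sub>2''(v) \<partial>\<^sub>2w)\<close> equal to the rotated gradient of \<open>f\<^sub>2'(v)\<close>, so testing it with a
  compactly supported \<open>b\<close> amounts to integrating the Jacobian of \<open>(f\<^sub>2'(v), b)\<close>, which vanishes.
  The choice \<open>b = \<eta>\<^sup>2 h(w)\<close> with \<open>h(y) = y (1 + y\<^sup>2) powr ((\<epsilon> - 1) / 2)\<close> gives a Caccioppoli inequality
  whose right-hand side has weight \<open>(1 + w\<^sup>2) powr ((1 + \<epsilon>) / 2)\<close>. If the claim failed, then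
  \<open>\<bar>w\<bar> \<ge> c \<bar>x\<^sub>1\<bar> powr \<kappa>\<^sub>1\<close> far out in \<open>M\<^sub>1\<close>; with a product cutoff \<open>\<eta>\<close> of widths \<open>R\<close> and
  \<open>S = R powr (1 + \<rho>)\<close> the support of \<open>\<partial>\<^sub>1\<eta>\<close> lies in \<open>M\<^sub>1\<close> and that of \<open>\<partial>\<^sub>2\<eta>\<close> in \<open>M\<^sub>2\<close>, and the right-hand
  side is of order \<open>R powr (\<rho> - \<kappa>\<^sub>1 (\<mu>\<^sub>1 - 1 - \<epsilon>)) + R powr (1 + (1 + \<rho>) (\<kappa>\<^sub>2 (1 + \<epsilon>) - 1))\<close>.
  For small \<open>\<epsilon>\<close> this tends to \<open>0\<close>, so \<open>w\<close> is constant, contradicting its growth.\<close>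

section \<open>Calculus in two separate real variables, up to the vanishing of Jacobian
  integrals\<close>

lemma continuous_on_binary:
  fixes g :: "real \<Rightarrow> real \<Rightarrow> real"
  assumes "continuous_on UNIV (\<lambda>p. g (fst p) (snd p))" "continuous_on S \<alpha>" "continuous_on S \<beta>"
  shows "continuous_on S (\<lambda>x. g (\<alpha> x) (\<beta> x))"
  using continuous_on_compose2[OF assms(1) continuous_on_Pair[OF assms(2,3)]] by simp

text \<open>An increment splits into a step in the second variable, controlled uniformly by the
  continuity of \<open>g2\<close>, and a step in the first variable at fixed \<open>t\<close>. This
  asymmetric form suits functions whose two partial derivatives are obtained by different means,
  such as \<open>J\<close> in the Jacobian lemma below.\<close>

lemma has_derivative_from_partials:
  fixes g g1 g2 :: "real \<Rightarrow> real \<Rightarrow> real"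
  assumes d1: "\<And>s t. ((\<lambda>s. g s t) has_real_derivative g1 s t) (at s)"
    and d2: "\<And>s t. ((\<lambda>t. g s t) has_real_derivative g2 s t) (at t)"
    and c2: "continuous_on UNIV (\<lambda>p. g2 (fst p) (snd p))"
  shows "((\<lambda>p. g (fst p) (snd p)) has_derivative (\<lambda>h. g1 s t * fst h + g2 s t * snd h)) (at (s, t))"
proof -
  have "((\<lambda>(x, y). g x y) has_derivative
      (\<lambda>(tx, ty). g1 s t * tx + blinfun_apply (blinfun_mult_right (g2 s t)) ty)) (at (s, t) within UNIV \<times> UNIV)"
  proof (rule has_derivative_partialsI)
    show "((\<lambda>x. g x t) has_derivative (*) (g1 s t)) (at s)"
      using d1[of t s] by (simp add: has_field_derivative_def)
    show "((\<lambda>y. g x y) has_derivative blinfun_apply (blinfun_mult_right (g2 x y))) (at y)" for x y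
      using d2[of x y] by (simp add: has_field_derivative_def)
    have "continuous_on UNIV (\<lambda>p. blinfun_mult_right (g2 (fst p) (snd p)))"
      by (rule bounded_linear.continuous_on[OF bounded_linear_blinfun_mult_right c2])
    thus "continuous (at (s, t) within UNIV \<times> UNIV) (\<lambda>(x, y). blinfun_mult_right (g2 x y))"
      by (simp add: continuous_on_eq_continuous_at split_beta' del: split_paired_All)
  qed auto
  thus ?thesis by (simp add: split_beta')
qed

lemma continuous_from_partials:
  fixes g g1 g2 :: "real \<Rightarrow> real \<Rightarrow> real"
  assumes "\<And>s t. ((\<lambda>s. g s t) has_real_derivative g1 s t) (at s)"
    and "\<And>s t. ((\<lambda>t. g s t) has_real_derivative g2 s t) (at t)"
    and "continuous_on UNIV (\<lambda>p. g2 (fst p) (snd p))"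
  shows "continuous_on UNIV (\<lambda>p. g (fst p) (snd p))"
  using has_derivative_from_partials[OF assms, THEN has_derivative_continuous]
  by (auto simp: continuous_on_eq_continuous_at)

text \<open>Chain rule along the curve \<open>s\<close> to \<open>(s, s)\<close>. It recombines the
  two arguments after a variable has been decoupled.\<close>

lemma has_real_derivative_diagonal:
  fixes g g1 g2 :: "real \<Rightarrow> real \<Rightarrow> real"
  assumes "\<And>s t. ((\<lambda>s. g s t) has_real_derivative g1 s t) (at s)"
    and "\<And>s t. ((\<lambda>t. g s t) has_real_derivative g2 s t) (at t)"
    and "continuous_on UNIV (\<lambda>p. g2 (fst p) (snd p))"
  shows "((\<lambda>s. g s s) has_real_derivative g1 s s + g2 s s) (at s)"
proof -
  have "((\<lambda>s. (s, s)) has_derivative (\<lambda>h. (h, h))) (at s)"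
    by (auto intro!: derivative_eq_intros)
  from has_derivative_compose[OF this has_derivative_from_partials[OF assms]]
  have "((\<lambda>s. g s s) has_derivative (\<lambda>h. g1 s s * h + g2 s s * h)) (at s)"
    by simp
  also have "(\<lambda>h. g1 s s * h + g2 s s * h) = (*) (g1 s s + g2 s s)"
    by (simp add: fun_eq_iff algebra_simps)
  finally show ?thesis
    by (simp add: has_field_derivative_def)
qed

lemma has_real_derivative_integral_param:
  fixes g g1 :: "real \<Rightarrow> real \<Rightarrow> real"
  assumes "\<And>s y. ((\<lambda>s. g s y) has_real_derivative g1 s y) (at s)"
    and c: "continuous_on UNIV (\<lambda>p. g (fst p) (snd p))"
    and c1: "continuous_on UNIV (\<lambda>p. g1 (fst p) (snd p))"
  shows "((\<lambda>s. integral {l..r} (g s)) has_real_derivative integral {l..r} (g1 s)) (at s)"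
proof -
  have "((\<lambda>s. integral (cbox l r) (g s)) has_real_derivative integral (cbox l r) (g1 s)) (at s)"
  proof (rule leibniz_rule_field_derivative)
    show "g s integrable_on cbox l r" for s
      by (rule integrable_continuous) (intro continuous_on_binary[OF c] continuous_intros)
    show "continuous_on (UNIV \<times> cbox l r) (\<lambda>(x, t). g1 x t)"
      unfolding split_beta by (rule continuous_on_subset[OF c1]) auto
  qed (use assms in auto)
  thus ?thesis by simp
qed

text \<open>Schwarz's theorem by integration: \<open>U2\<close> is integrated in the second
  variable, the result is differentiated in the first under the integral sign, and the fundamental
  theorem of calculus then removes the integral.\<close>

lemma mixed_partials_eq:
  fixes U U1 U2 U12 U21 :: "real \<Rightarrow> real \<Rightarrow> real"
  assumes d1: "\<And>s t. ((\<lambda>s. U s t) has_real_derivative U1 s t) (at s)"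
    and d2: "\<And>s t. ((\<lambda>t. U s t) has_real_derivative U2 s t) (at t)"
    and d12: "\<And>s t. ((\<lambda>t. U1 s t) has_real_derivative U12 s t) (at t)"
    and d21: "\<And>s t. ((\<lambda>s. U2 s t) has_real_derivative U21 s t) (at s)"
    and c2: "continuous_on UNIV (\<lambda>p. U2 (fst p) (snd p))"
    and c21: "continuous_on UNIV (\<lambda>p. U21 (fst p) (snd p))"
  shows "U12 s t = U21 s t"
proof -
  \<comment> \<open>The radius 1 is arbitrary. The integral needs a base point below
    \<open>t\<close>, and \<open>t\<close> must be interior to \<open>{a..b}\<close> so that the
    derivative within the interval is the full derivative.\<close>
  define a where "a = t - 1"
  define b where "b = t + 1"
  have ab: "a < t" "t < b" by (auto simp: a_def b_def)
  have eq: "U1 s y - U1 s a = integral {a..y} (U21 s)" if "y \<in> {a..b}" for y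
  proof -
    have "integral {a..y} (U2 s') = U s' y - U s' a" for s'
      using that d2
      by (intro integral_unique fundamental_theorem_of_calculus)
         (auto simp: has_real_derivative_iff_has_vector_derivative intro: has_vector_derivative_at_within)
    hence "((\<lambda>s'. U s' y - U s' a) has_real_derivative integral {a..y} (U21 s)) (at s)"
      using has_real_derivative_integral_param[OF d21 c2 c21, of a y s] by simp
    moreover have "((\<lambda>s'. U s' y - U s' a) has_real_derivative U1 s y - U1 s a) (at s)"
      by (intro DERIV_diff d1)
    ultimately show ?thesis by (metis DERIV_unique)
  qed
  have "((\<lambda>y. integral {a..y} (U21 s)) has_real_derivative U21 s t) (at t within {a..b})"
    using ab by (intro integral_has_real_derivative continuous_on_binary[OF c21] continuous_intros) auto
  hence "((\<lambda>y. U1 s y - U1 s a) has_real_derivative U21 s t) (at t within {a..b})"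
    by (rule has_field_derivative_transform_within[where d = 1]) (use ab eq in auto)
  moreover have "at t within {a..b} = at t"
    using ab by (simp add: at_within_Icc_at)
  moreover have "((\<lambda>y. U1 s y - U1 s a) has_real_derivative U12 s t - 0) (at t)"
    by (intro DERIV_diff d12 DERIV_const)
  ultimately show ?thesis by (metis DERIV_unique diff_zero)
qed

text \<open>Formally the integrand is the divergence of \<open>(a * b2, - a * b1)\<close>. Its flux
  through the boundary of the rectangle involves only tangential derivatives of \<open>b\<close>,
  which vanish there. The proof works with first derivatives alone.\<close>

lemma integral_jacobian_eq_0:
  fixes a b a1 a2 b1 b2 :: "real \<Rightarrow> real \<Rightarrow> real"
  assumes da1: "\<And>s t. ((\<lambda>s. a s t) has_real_derivative a1 s t) (at s)"
    and da2: "\<And>s t. ((\<lambda>t. a s t) has_real_derivative a2 s t) (at t)"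
    and db1: "\<And>s t. ((\<lambda>s. b s t) has_real_derivative b1 s t) (at s)"
    and db2: "\<And>s t. ((\<lambda>t. b s t) has_real_derivative b2 s t) (at t)"
    and ca1: "continuous_on UNIV (\<lambda>p. a1 (fst p) (snd p))"
    and ca2: "continuous_on UNIV (\<lambda>p. a2 (fst p) (snd p))"
    and cb1: "continuous_on UNIV (\<lambda>p. b1 (fst p) (snd p))"
    and cb2: "continuous_on UNIV (\<lambda>p. b2 (fst p) (snd p))"
    and bd: "\<And>t. b A t = 0" "\<And>t. b A' t = 0" "\<And>s. b s B = 0" "\<And>s. b s B' = 0"
    and le: "A \<le> A'" "B \<le> B'"
  shows "integral (cbox (A, B) (A', B'))
     (\<lambda>p. a1 (fst p) (snd p) * b2 (fst p) (snd p) - a2 (fst p) (snd p) * b1 (fst p) (snd p)) = 0"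
proof -
  have ca: "continuous_on UNIV (\<lambda>p. a (fst p) (snd p))"
    by (rule continuous_from_partials[OF da1 da2 ca2])
  have cb: "continuous_on UNIV (\<lambda>p. b (fst p) (snd p))"
    by (rule continuous_from_partials[OF db1 db2 cb2])
  note cont = continuous_on_binary[OF ca] continuous_on_binary[OF ca1] continuous_on_binary[OF ca2]
    continuous_on_binary[OF cb] continuous_on_binary[OF cb1] continuous_on_binary[OF cb2]
  \<comment> \<open>Decoupling the first variable avoids second derivatives of \<open>b\<close>: both partial derivatives of \<open>J\<close>
    exist, and they sum to the inner Jacobian integral on the diagonal.\<close>
  define J where "J s t = integral {B..B'} (\<lambda>y. a s y * b2 t y)" for s t
  \<comment> \<open>Integration by parts in \<open>y\<close> moves the derivative from
    \<open>b\<close> to \<open>a\<close>; the boundary terms vanish. In this form the dependence on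
    \<open>t\<close> sits in \<open>b\<close> itself, so differentiating in \<open>t\<close>
    produces \<open>b1\<close> and no second derivative.\<close>
  have J_alt: "J s t = integral {B..B'} (\<lambda>y. - (a2 s y * b t y))" for s t
  proof -
    have "((\<lambda>y. a2 s y * b t y + a s y * b2 t y) has_integral a s B' * b t B' - a s B * b t B) {B..B'}"
    proof (rule fundamental_theorem_of_calculus)
      fix y
      show "((\<lambda>y. a s y * b t y) has_vector_derivative a2 s y * b t y + a s y * b2 t y) (at y within {B..B'})"
        unfolding has_real_derivative_iff_has_vector_derivative[symmetric]
        by (rule has_field_derivative_at_within) (auto intro!: derivative_eq_intros da2 db2)
    qed (use le in auto)
    moreover have "((\<lambda>y. a2 s y * b t y) has_integral integral {B..B'} (\<lambda>y. a2 s y * b t y)) {B..B'}"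
      by (intro integrable_integral integrable_continuous_interval continuous_intros cont)
    ultimately have "((\<lambda>y. a2 s y * b t y + a s y * b2 t y - a2 s y * b t y) has_integral
        a s B' * b t B' - a s B * b t B - integral {B..B'} (\<lambda>y. a2 s y * b t y)) {B..B'}"
      by (rule has_integral_diff)
    hence "((\<lambda>y. a s y * b2 t y) has_integral - integral {B..B'} (\<lambda>y. a2 s y * b t y)) {B..B'}"
      by (simp add: bd)
    thus ?thesis
      by (simp add: J_def integral_unique)
  qed
  have J1: "((\<lambda>s. J s t) has_real_derivative integral {B..B'} (\<lambda>y. a1 s y * b2 t y)) (at s)" for s t
    unfolding J_def
    by (rule has_real_derivative_integral_param[where g = "\<lambda>s y. a s y * b2 t y"])
       (intro continuous_intros cont DERIV_cmult_right da1)+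
  have J2: "((\<lambda>t. J s t) has_real_derivative integral {B..B'} (\<lambda>y. - (a2 s y * b1 t y))) (at t)" for s t
    unfolding J_alt
    by (rule has_real_derivative_integral_param[where g = "\<lambda>t y. - (a2 s y * b t y)"])
       (intro continuous_intros cont DERIV_minus DERIV_cmult db1)+
  have cJ2: "continuous_on UNIV (\<lambda>p. integral {B..B'} (\<lambda>y. - (a2 (fst p) y * b1 (snd p) y)))"
    unfolding interval_cbox
    by (rule integral_continuous_on_param) (unfold split_beta, intro continuous_intros cont)
  have J': "((\<lambda>s. J s s) has_real_derivative
      integral {B..B'} (\<lambda>y. a1 s y * b2 s y - a2 s y * b1 s y)) (at s)" for s
  proof -
    have "integral {B..B'} (\<lambda>y. a1 s y * b2 s y - a2 s y * b1 s y)
        = integral {B..B'} (\<lambda>y. a1 s y * b2 s y + - (a2 s y * b1 s y))" by simp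
    also have "\<dots> = integral {B..B'} (\<lambda>y. a1 s y * b2 s y) + integral {B..B'} (\<lambda>y. - (a2 s y * b1 s y))"
      by (intro integral_add integrable_continuous_interval continuous_intros cont)
    finally show ?thesis
      using has_real_derivative_diagonal[OF J1 J2 cJ2, of s] by simp
  qed
  have "integral (cbox (A, B) (A', B'))
     (\<lambda>p. a1 (fst p) (snd p) * b2 (fst p) (snd p) - a2 (fst p) (snd p) * b1 (fst p) (snd p))
     = integral {A..A'} (\<lambda>s. integral {B..B'} (\<lambda>y. a1 s y * b2 s y - a2 s y * b1 s y))"
    by (subst integral_prod_continuous) (intro continuous_intros cont | simp)+
  also have "\<dots> = J A' A' - J A A"
    using le J'
    by (intro integral_unique fundamental_theorem_of_calculus)
       (auto simp: has_real_derivative_iff_has_vector_derivative intro: has_vector_derivative_at_within)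
  \<comment> \<open>By \<open>J_alt\<close>, the integrands at the two ends carry the factors
    \<open>b A' y\<close> and \<open>b A y\<close>, which are zero.\<close>
  also have "\<dots> = 0" by (simp add: J_alt bd)
  finally show ?thesis .
qed

section \<open>One-dimensional building blocks: the cutoff and the test profile\<close>

lemma has_real_derivative_max_0_power2:
  "((\<lambda>x::real. (max 0 x)\<^sup>2) has_real_derivative 2 * max 0 x) (at x)"
proof (cases x "0::real" rule: linorder_cases)
  case less
  have "((\<lambda>_. 0) has_real_derivative 0) (at x)" by simp
  hence "((\<lambda>x::real. (max 0 x)\<^sup>2) has_real_derivative 0) (at x)"
    by (rule has_field_derivative_transform_within[where d = "- x"])
       (use less in \<open>auto simp: dist_real_def\<close>)
  thus ?thesis using less by simp
next
  case equal
  have "((\<lambda>h. (max 0 h)\<^sup>2 / h) \<longlongrightarrow> (0::real)) (at 0)"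
    by (rule Lim_null_comparison[where g = "\<lambda>h. \<bar>h\<bar>"])
       (auto intro!: tendsto_eq_intros always_eventually simp: max_def power2_eq_square)
  thus ?thesis using equal by (simp add: DERIV_def)
next
  case greater
  have "((\<lambda>x. x\<^sup>2) has_real_derivative 2 * x) (at x)" by (auto intro!: derivative_eq_intros)
  hence "((\<lambda>x::real. (max 0 x)\<^sup>2) has_real_derivative 2 * x) (at x)"
    by (rule has_field_derivative_transform_within[where d = "x"])
       (use greater in \<open>auto simp: dist_real_def\<close>)
  thus ?thesis using greater by simp
qed

text \<open>A piecewise polynomial cutoff is enough, since the energy estimate differentiates it
  only once. Squares of positive parts are continuously differentiable, so nesting two of them joins
  the plateau to zero.\<close>

lemma obtain_cutoff:
  obtains \<psi> \<psi>' :: "real \<Rightarrow> real" where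
    "\<And>t. (\<psi> has_real_derivative \<psi>' t) (at t)" "continuous_on UNIV \<psi>'"
    "\<And>t. 0 \<le> \<psi> t" "\<And>t. \<psi> t \<le> 1"
    "\<And>t. \<bar>t\<bar> \<le> 1 \<Longrightarrow> \<psi> t = 1" "\<And>t. \<bar>t\<bar> \<ge> 2 \<Longrightarrow> \<psi> t = 0"
    "\<And>t. \<psi>' t \<noteq> 0 \<Longrightarrow> 1 \<le> \<bar>t\<bar>" "\<And>t. \<bar>\<psi>' t\<bar> \<le> 4"
proof -
  \<comment> \<open>\<open>g t\<close> is the squared distance of \<open>t\<close> from the interval
    \<open>[-1, 1]\<close>: at most one of the two summands is nonzero. It vanishes on the plateau
    and is at least 1 once |t| is at least 2.\<close>
  define g :: "real \<Rightarrow> real" where "g t = (max 0 (t - 1))\<^sup>2 + (max 0 (- t - 1))\<^sup>2" for t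
  define \<psi> where "\<psi> t = (max 0 (1 - g t))\<^sup>2" for t
  define \<psi>' where "\<psi>' t = - (4 * max 0 (1 - g t) * (max 0 (t - 1) - max 0 (- t - 1)))" for t
  have g: "g t \<ge> 0" for t by (simp add: g_def)
  have dg: "(g has_real_derivative 2 * max 0 (t - 1) - 2 * max 0 (- t - 1)) (at t)" for t
    unfolding g_def
    by (rule DERIV_cong[OF DERIV_add[OF DERIV_chain2[OF has_real_derivative_max_0_power2]
              DERIV_chain2[OF has_real_derivative_max_0_power2]]])
       (auto intro!: derivative_eq_intros)
  show ?thesis
  proof (rule that[of \<psi> \<psi>'])
    show "(\<psi> has_real_derivative \<psi>' t) (at t)" for t
      unfolding \<psi>_def \<psi>'_def
      by (rule DERIV_cong[OF DERIV_chain2[OF has_real_derivative_max_0_power2 DERIV_diff[OF DERIV_const dg]]])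
         (simp add: algebra_simps)
    show "continuous_on UNIV \<psi>'"
      unfolding \<psi>'_def g_def by (intro continuous_intros)
    show "0 \<le> \<psi> t" for t by (simp add: \<psi>_def)
    show "\<psi> t \<le> 1" for t
      unfolding \<psi>_def by (rule power_le_one) (use g[of t] in auto)
    show "\<psi> t = 1" if "\<bar>t\<bar> \<le> 1" for t
    proof -
      have "max 0 (t - 1) = 0" "max 0 (- t - 1) = 0" using that by auto
      thus ?thesis by (simp add: \<psi>_def g_def)
    qed
    show "\<psi> t = 0" if "\<bar>t\<bar> \<ge> 2" for t
    proof -
      have "1 \<le> max 0 (t - 1) \<or> 1 \<le> max 0 (- t - 1)" using that by auto
      hence "1 \<le> (max 0 (t - 1))\<^sup>2 \<or> 1 \<le> (max 0 (- t - 1))\<^sup>2"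
        by (metis one_le_power)
      hence "g t \<ge> 1"
        unfolding g_def by (smt (verit) zero_le_power2)
      thus ?thesis by (simp add: \<psi>_def)
    qed
    show "1 \<le> \<bar>t\<bar>" if "\<psi>' t \<noteq> 0" for t
      using that by (rule contrapos_np) (auto simp: \<psi>'_def max_def)
    show "\<bar>\<psi>' t\<bar> \<le> 4" for t
    proof (cases "g t < 1")
      case True
      have "(max 0 (t - 1))\<^sup>2 < 1\<^sup>2" "(max 0 (- t - 1))\<^sup>2 < 1\<^sup>2"
        using True unfolding g_def by (smt (verit) zero_le_power2 one_power2)+
      hence "max 0 (t - 1) < 1" "max 0 (- t - 1) < 1"
        by (meson power2_less_imp_less zero_le_one)+
      hence "\<bar>max 0 (t - 1) - max 0 (- t - 1)\<bar> \<le> 1" by linarith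
      moreover have "\<bar>max 0 (1 - g t)\<bar> \<le> 1" using g[of t] by auto
      ultimately have "\<bar>max 0 (1 - g t)\<bar> * \<bar>max 0 (t - 1) - max 0 (- t - 1)\<bar> \<le> 1 * 1"
        by (intro mult_mono) auto
      thus ?thesis by (simp add: \<psi>'_def abs_mult)
    qed (simp add: \<psi>'_def max_def)
  qed
qed

text \<open>\<open>h y = y * (1 + y\<^sup>2) powr ((\<epsilon> - 1) / 2)\<close> is increasing and
  grows like the power \<epsilon> of |y|. Its derivative is at least
  \<open>\<epsilon> * (1 + y\<^sup>2) powr ((\<epsilon> - 1) / 2)\<close>, which bounds the quotient
  at the cost of a factor 1/\<epsilon>. The resulting weight lies only slightly above linear growth,
  so that a coefficient decaying with an exponent above 1 can still beat it.\<close>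

lemma obtain_power_profile:
  fixes \<epsilon> :: real
  assumes "0 < \<epsilon>" "\<epsilon> \<le> 1"
  obtains h h' :: "real \<Rightarrow> real" where
    "\<And>y. (h has_real_derivative h' y) (at y)" "continuous_on UNIV h'"
    "\<And>y. h' y > 0" "\<And>y. (h y)\<^sup>2 / h' y \<le> (1 + y\<^sup>2) powr ((1 + \<epsilon>) / 2) / \<epsilon>"
proof -
  define \<alpha> where "\<alpha> = (\<epsilon> - 1) / 2"
  define h where "h y = y * (1 + y\<^sup>2) powr \<alpha>" for y :: real
  define h' where "h' y = (1 + y\<^sup>2) powr (\<alpha> - 1) * (1 + \<epsilon> * y\<^sup>2)" for y :: real
  have pos: "1 + y\<^sup>2 > 0" for y :: real by (smt (verit) zero_le_power2)
  have split: "(1 + y\<^sup>2) powr \<alpha> = (1 + y\<^sup>2) powr (\<alpha> - 1) * (1 + y\<^sup>2)" for y :: real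
    using pos[of y] by (simp add: powr_diff)
  have \<epsilon>_eq: "\<epsilon> = 2 * \<alpha> + 1" by (simp add: \<alpha>_def field_simps)
  have lower: "\<epsilon> * (1 + y\<^sup>2) powr \<alpha> \<le> h' y" for y
  proof -
    have "(1 + y\<^sup>2) powr (\<alpha> - 1) * (\<epsilon> * (1 + y\<^sup>2)) \<le> h' y"
      unfolding h'_def using assms by (intro mult_left_mono) (auto simp: algebra_simps)
    thus ?thesis by (simp add: split algebra_simps)
  qed
  show ?thesis
  proof (rule that[of h h'])
    show "(h has_real_derivative h' y) (at y)" for y
    proof -
      have "(h has_real_derivative (1 + y\<^sup>2) powr \<alpha> + y * (\<alpha> * (1 + y\<^sup>2) powr (\<alpha> - 1) * (2 * y))) (at y)"
        unfolding h_def using pos[of y]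
        by (auto intro!: derivative_eq_intros simp: powr_diff divide_simps)
      also have "(1 + y\<^sup>2) powr \<alpha> + y * (\<alpha> * (1 + y\<^sup>2) powr (\<alpha> - 1) * (2 * y)) = h' y"
        unfolding h'_def split \<epsilon>_eq by (simp add: algebra_simps power2_eq_square)
      finally show ?thesis .
    qed
    show "continuous_on UNIV h'"
      unfolding h'_def using pos by (intro continuous_intros) (auto simp: less_imp_neq[symmetric])
    show h'_pos: "h' y > 0" for y
      unfolding h'_def using assms pos[of y] by (intro mult_pos_pos) (auto intro: add_pos_nonneg)
    show "(h y)\<^sup>2 / h' y \<le> (1 + y\<^sup>2) powr ((1 + \<epsilon>) / 2) / \<epsilon>" for y
    proof -
      have p: "(1 + y\<^sup>2) powr \<alpha> > 0" using pos[of y] by simp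
      have "(h y)\<^sup>2 / h' y \<le> (h y)\<^sup>2 / (\<epsilon> * (1 + y\<^sup>2) powr \<alpha>)"
        using lower[of y] p assms h'_pos[of y] by (intro divide_left_mono mult_pos_pos) auto
      also have "\<dots> = y\<^sup>2 * (1 + y\<^sup>2) powr \<alpha> / \<epsilon>"
        using p by (simp add: h_def power2_eq_square)
      also have "\<dots> \<le> (1 + y\<^sup>2) * (1 + y\<^sup>2) powr \<alpha> / \<epsilon>"
        using assms p by (intro divide_right_mono mult_right_mono) auto
      also have "(1 + y\<^sup>2) * (1 + y\<^sup>2) powr \<alpha> = (1 + y\<^sup>2) powr (1 + \<alpha>)"
        using pos[of y] by (simp add: powr_add)
      also have "1 + \<alpha> = (1 + \<epsilon>) / 2" by (simp add: \<alpha>_def field_simps)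
      finally show ?thesis .
    qed
  qed
qed

section \<open>Weighted energy estimates for solutions of the split equation\<close>

text \<open>Here \<open>a = f\<^sub>1''\<close>, \<open>G = f\<^sub>2'\<close>, \<open>g = f\<^sub>2''\<close>; the suffixes 1 and 2 denote partial derivatives.\<close>

locale split_solution =
  fixes a G g :: "real \<Rightarrow> real" and w w1 w2 v v1 v2 :: "real \<Rightarrow> real \<Rightarrow> real"
  assumes dw1: "\<And>s t. ((\<lambda>s. w s t) has_real_derivative w1 s t) (at s)"
    and dw2: "\<And>s t. ((\<lambda>t. w s t) has_real_derivative w2 s t) (at t)"
    and dv1: "\<And>s t. ((\<lambda>s. v s t) has_real_derivative v1 s t) (at s)"
    and dv2: "\<And>s t. ((\<lambda>t. v s t) has_real_derivative v2 s t) (at t)"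
    and cw1: "continuous_on UNIV (\<lambda>p. w1 (fst p) (snd p))"
    and cw2: "continuous_on UNIV (\<lambda>p. w2 (fst p) (snd p))"
    and cv1: "continuous_on UNIV (\<lambda>p. v1 (fst p) (snd p))"
    and cv2: "continuous_on UNIV (\<lambda>p. v2 (fst p) (snd p))"
    and curl_free: "\<And>s t. v1 s t = w2 s t"
    and dG: "\<And>y. (G has_real_derivative g y) (at y)"
    and ca: "continuous_on UNIV a" and cg: "continuous_on UNIV g"
    and a_pos: "\<And>y. 0 < a y" and g_pos: "\<And>y. 0 < g y"
    and pde: "\<And>s t. a (w s t) * w1 s t + g (v s t) * v2 s t = 0"
begin

abbreviation energy :: "real \<Rightarrow> real \<Rightarrow> real" where
  "energy s t \<equiv> a (w s t) * (w1 s t)\<^sup>2 + g (v s t) * (w2 s t)\<^sup>2"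

lemmas cont_w = continuous_on_binary[OF continuous_from_partials[OF dw1 dw2 cw2]]
lemmas cont_v = continuous_on_binary[OF continuous_from_partials[OF dv1 dv2 cv2]]
lemmas cont_partials = continuous_on_binary[OF cw1] continuous_on_binary[OF cw2]
  continuous_on_binary[OF cv1] continuous_on_binary[OF cv2]
lemmas cont_coeffs = continuous_on_compose2[OF ca] continuous_on_compose2[OF cg]

text \<open>For \<open>b = \<eta>\<^sup>2 h(w)\<close> the Jacobian of \<open>(G(v), b)\<close> is
  the weighted energy plus cross terms containing \<open>\<eta>1\<close> and \<open>\<eta>2\<close>.
  Its integral is zero, and Young's inequality absorbs the cross terms into half of the energy,
  which leaves the constant 4.\<close>

lemma caccioppoli:
  fixes h h' :: "real \<Rightarrow> real" and \<eta> \<eta>1 \<eta>2 :: "real \<Rightarrow> real \<Rightarrow> real"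
  assumes dh: "\<And>y. (h has_real_derivative h' y) (at y)" and ch': "continuous_on UNIV h'"
    and h'_pos: "\<And>y. h' y > 0"
    and d\<eta>1: "\<And>s t. ((\<lambda>s. \<eta> s t) has_real_derivative \<eta>1 s t) (at s)"
    and d\<eta>2: "\<And>s t. ((\<lambda>t. \<eta> s t) has_real_derivative \<eta>2 s t) (at t)"
    and c\<eta>1: "continuous_on UNIV (\<lambda>p. \<eta>1 (fst p) (snd p))"
    and c\<eta>2: "continuous_on UNIV (\<lambda>p. \<eta>2 (fst p) (snd p))"
    and bd: "\<And>t. \<eta> A t = 0" "\<And>t. \<eta> A' t = 0" "\<And>s. \<eta> s B = 0" "\<And>s. \<eta> s B' = 0"
    and le: "A \<le> A'" "B \<le> B'"
  shows "integral (cbox (A, B) (A', B'))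
           (\<lambda>(s, t). (\<eta> s t)\<^sup>2 * (h' (w s t) * energy s t))
       \<le> integral (cbox (A, B) (A', B'))
           (\<lambda>(s, t). 4 * ((h (w s t))\<^sup>2 / h' (w s t)) *
              (a (w s t) * (\<eta>1 s t)\<^sup>2 + g (v s t) * (\<eta>2 s t)\<^sup>2))"
    (is "integral ?Q ?L \<le> integral ?Q ?R")
proof -
  define b where "b s t = (\<eta> s t)\<^sup>2 * h (w s t)" for s t
  define b1 where "b1 s t = 2 * \<eta> s t * \<eta>1 s t * h (w s t) + (\<eta> s t)\<^sup>2 * (h' (w s t) * w1 s t)" for s t
  define b2 where "b2 s t = 2 * \<eta> s t * \<eta>2 s t * h (w s t) + (\<eta> s t)\<^sup>2 * (h' (w s t) * w2 s t)" for s t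
  define \<Gamma>1 where "\<Gamma>1 s t = g (v s t) * v1 s t" for s t
  define \<Gamma>2 where "\<Gamma>2 s t = g (v s t) * v2 s t" for s t
  have ch: "continuous_on UNIV h"
    using dh DERIV_continuous_on by blast
  note cont = cont_w cont_v cont_partials cont_coeffs
    continuous_on_binary[OF c\<eta>1] continuous_on_binary[OF c\<eta>2]
    continuous_on_binary[OF continuous_from_partials[OF d\<eta>1 d\<eta>2 c\<eta>2]]
    continuous_on_compose2[OF ch] continuous_on_compose2[OF ch'] subset_UNIV
  let ?J = "\<lambda>p. \<Gamma>1 (fst p) (snd p) * b2 (fst p) (snd p) - \<Gamma>2 (fst p) (snd p) * b1 (fst p) (snd p)"
  have J0: "integral ?Q ?J = 0"
  proof (rule integral_jacobian_eq_0[where a = "\<lambda>s t. G (v s t)" and b = b])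
    show "((\<lambda>s. G (v s t)) has_real_derivative \<Gamma>1 s t) (at s)" for s t
      unfolding \<Gamma>1_def by (rule DERIV_chain2[OF dG dv1])
    show "((\<lambda>t. G (v s t)) has_real_derivative \<Gamma>2 s t) (at t)" for s t
      unfolding \<Gamma>2_def by (rule DERIV_chain2[OF dG dv2])
    show "((\<lambda>s. b s t) has_real_derivative b1 s t) (at s)" for s t
      unfolding b_def b1_def
      by (auto intro!: derivative_eq_intros DERIV_chain2[OF dh dw1] d\<eta>1)
    show "((\<lambda>t. b s t) has_real_derivative b2 s t) (at t)" for s t
      unfolding b_def b2_def
      by (auto intro!: derivative_eq_intros DERIV_chain2[OF dh dw2] d\<eta>2)
    show "continuous_on UNIV (\<lambda>p. \<Gamma>1 (fst p) (snd p))" "continuous_on UNIV (\<lambda>p. \<Gamma>2 (fst p) (snd p))"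
      "continuous_on UNIV (\<lambda>p. b1 (fst p) (snd p))" "continuous_on UNIV (\<lambda>p. b2 (fst p) (snd p))"
      unfolding \<Gamma>1_def \<Gamma>2_def b1_def b2_def by (intro continuous_intros cont)+
  qed (use bd le in \<open>auto simp: b_def\<close>)
  have J_int: "?J integrable_on ?Q"
    unfolding \<Gamma>1_def \<Gamma>2_def b1_def b2_def by (intro integrable_continuous continuous_intros cont)
  have R_int: "?R integrable_on ?Q"
    unfolding split_beta
    by (intro integrable_continuous continuous_intros cont ballI less_imp_neq[symmetric] h'_pos)
  have L_int: "?L integrable_on ?Q"
    unfolding split_beta by (intro integrable_continuous continuous_intros cont)
  \<comment> \<open>Pointwise, the right side minus the left side is a sum of two squares with
    positive weights. The added Jacobian has integral zero.\<close>
  have key: "?L p \<le> ?R p + 2 * ?J p" for p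
  proof -
    obtain s t where p: "p = (s, t)" by (cases p)
    define X where "X = h' (w s t)"
    have X: "X > 0" by (simp add: X_def h'_pos)
    \<comment> \<open>The equation and the symmetry of second derivatives enter here: the gradient
      of \<open>G(v)\<close> becomes the rotated flux of the equation differentiated in the first
      variable.\<close>
    have \<Gamma>: "\<Gamma>1 s t = g (v s t) * w2 s t" "\<Gamma>2 s t = - (a (w s t) * w1 s t)"
      using pde[of s t] by (simp_all add: \<Gamma>1_def \<Gamma>2_def curl_free)
    have "0 \<le> (a (w s t) * (\<eta> s t * X * w1 s t + 2 * h (w s t) * \<eta>1 s t)\<^sup>2
            + g (v s t) * (\<eta> s t * X * w2 s t + 2 * h (w s t) * \<eta>2 s t)\<^sup>2) / X"
      using X a_pos[of "w s t"] g_pos[of "v s t"] by (intro divide_nonneg_pos add_nonneg_nonneg) auto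
    also have "\<dots> = ?R p + 2 * ?J p - ?L p"
      using X unfolding p \<Gamma> fst_conv snd_conv b1_def b2_def split X_def[symmetric]
      by (simp add: field_simps power2_eq_square)
    finally show ?thesis by simp
  qed
  have "integral ?Q ?L \<le> integral ?Q (\<lambda>p. ?R p + 2 * ?J p)"
    by (rule integral_le[OF L_int integrable_add[OF R_int integrable_on_mult_right[OF J_int]] key])
  also have "\<dots> = integral ?Q ?R + 2 * integral ?Q ?J"
    by (subst integral_add[OF R_int integrable_on_mult_right[OF J_int]]) (simp only: integral_mult_right)
  finally show ?thesis using J0 by simp
qed

text \<open>On every fixed box the weighted energy is bounded by a quantity that tends to zero as
  the cutoff expands, so \<open>w1\<close> vanishes identically. Then \<open>w\<close> is constant
  on the axis \<open>t = 0\<close>, which lies in the region of the lower growth bound.\<close>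

lemma entire_growth_contradiction:
  fixes \<mu> \<rho> \<kappa>1 \<kappa>2 c K T C1 C2 :: real
  assumes a_le: "\<And>y. a y \<le> C1 * (1 + y\<^sup>2) powr (- \<mu> / 2)" and g_le: "\<And>y. g y \<le> C2"
    and \<kappa>: "0 < \<kappa>1" "0 \<le> \<kappa>2" "\<kappa>2 < 1"
    and \<rho>: "\<kappa>2 / (1 - \<kappa>2) < \<rho>" "\<rho> < \<kappa>1 * (\<mu> - 1)"
    and c: "0 < c" and K: "0 \<le> K"
    and low: "\<And>s t. T \<le> \<bar>s\<bar> \<Longrightarrow> \<bar>t\<bar> \<le> 2 * \<bar>s\<bar> powr (1 + \<rho>) \<Longrightarrow> c * \<bar>s\<bar> powr \<kappa>1 \<le> \<bar>w s t\<bar>"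
    and up: "\<And>s t. T \<le> \<bar>t\<bar> \<Longrightarrow> \<bar>s\<bar> \<le> 2 * \<bar>t\<bar> powr (1 / (1 + \<rho>)) \<Longrightarrow> \<bar>w s t\<bar> \<le> K * \<bar>t\<bar> powr \<kappa>2"
  shows False
proof -
  have \<rho>0: "\<rho> > 0" using \<rho>(1) \<kappa> by (smt (verit) divide_nonneg_pos)
  have C: "C1 > 0" "C2 > 0"
    using a_le[of 0] a_pos[of 0] g_le[of 0] g_pos[of 0] by auto
  \<comment> \<open>The slack in the two bounds on \<rho>; the lower one is equivalent to
    \<open>(1 + \<rho>) * (1 - \<kappa>2) > 1\<close>.\<close>
  define \<delta>1 where "\<delta>1 = \<kappa>1 * (\<mu> - 1) - \<rho>"
  define \<delta>2 where "\<delta>2 = (1 + \<rho>) * (1 - \<kappa>2) - 1"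
  have \<delta>: "\<delta>1 > 0" "\<delta>2 > 0"
    using \<rho> \<kappa> by (auto simp: \<delta>1_def \<delta>2_def field_simps)
  \<comment> \<open>Each inner term makes \<epsilon> spend at most half of one slack; the outer 1 is
    the range of the profile lemma.\<close>
  define \<epsilon> where "\<epsilon> = min 1 (min (\<delta>1 / (2 * \<kappa>1)) (\<delta>2 / (2 * (1 + \<rho>))))"
  have \<epsilon>: "0 < \<epsilon>" "\<epsilon> \<le> 1"
    using \<delta> \<kappa> \<rho>0 by (auto simp: \<epsilon>_def)
  \<comment> \<open>The power left over when the weight
    \<open>(1 + w\<^sup>2) powr ((1 + \<epsilon>) / 2)\<close> meets the decay of \<open>a\<close>:
    their product is of order |w| to the power \<open>- m\<close>.\<close>
  define m where "m = \<mu> - 1 - \<epsilon>"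
  have exp1: "\<rho> - \<kappa>1 * m < 0"
  proof -
    have "\<epsilon> \<le> \<delta>1 / (2 * \<kappa>1)" by (simp add: \<epsilon>_def)
    hence "\<kappa>1 * \<epsilon> \<le> \<delta>1 / 2" using \<kappa> by (simp add: field_simps)
    thus ?thesis using \<delta> unfolding m_def \<delta>1_def by (simp add: algebra_simps)
  qed
  have m: "m > 0" using exp1 \<rho>0 \<kappa> by (smt (verit) zero_less_mult_pos)
  have exp2: "1 + (1 + \<rho>) * (\<kappa>2 * (1 + \<epsilon>) - 1) < 0"
  proof -
    have "\<epsilon> \<le> \<delta>2 / (2 * (1 + \<rho>))" by (simp add: \<epsilon>_def)
    hence "(1 + \<rho>) * \<epsilon> \<le> \<delta>2 / 2" using \<rho>0 by (simp add: field_simps)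
    moreover have "\<kappa>2 * ((1 + \<rho>) * \<epsilon>) \<le> 1 * ((1 + \<rho>) * \<epsilon>)"
      using \<kappa> \<epsilon> \<rho>0 by (intro mult_right_mono) auto
    ultimately have "\<kappa>2 * ((1 + \<rho>) * \<epsilon>) < \<delta>2" using \<delta> by linarith
    thus ?thesis unfolding \<delta>2_def by (simp add: algebra_simps)
  qed
  obtain \<psi> \<psi>' :: "real \<Rightarrow> real" where \<psi>:
    "\<And>t. (\<psi> has_real_derivative \<psi>' t) (at t)" "continuous_on UNIV \<psi>'"
    "\<And>t. 0 \<le> \<psi> t" "\<And>t. \<psi> t \<le> 1"
    "\<And>t. \<bar>t\<bar> \<le> 1 \<Longrightarrow> \<psi> t = 1" "\<And>t. \<bar>t\<bar> \<ge> 2 \<Longrightarrow> \<psi> t = 0"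
    "\<And>t. \<psi>' t \<noteq> 0 \<Longrightarrow> 1 \<le> \<bar>t\<bar>" "\<And>t. \<bar>\<psi>' t\<bar> \<le> 4"
    by (rule obtain_cutoff) blast
  obtain h h' :: "real \<Rightarrow> real" where h:
    "\<And>y. (h has_real_derivative h' y) (at y)" "continuous_on UNIV h'"
    "\<And>y. h' y > 0" "\<And>y. (h y)\<^sup>2 / h' y \<le> (1 + y\<^sup>2) powr ((1 + \<epsilon>) / 2) / \<epsilon>"
    by (rule obtain_power_profile[OF \<epsilon>]) blast
  have c\<psi>: "continuous_on UNIV \<psi>" and ch: "continuous_on UNIV h"
    using \<psi>(1) h(1) DERIV_continuous_on by blast+
  note cont = cont_w cont_v cont_partials cont_coeffs
    continuous_on_compose2[OF c\<psi>] continuous_on_compose2[OF \<psi>(2)]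
    continuous_on_compose2[OF ch] continuous_on_compose2[OF h(2)] subset_UNIV
  \<comment> \<open>The factor 16 is the square of the bound 4 on the cutoff derivative. In
    \<open>bnd\<close>, 64 is the Caccioppoli constant 4 times the 16 from the area
    \<open>(4 * R) * (4 * S)\<close>.\<close>
  define A1 where "A1 = 16 * C1 * c powr (- m) / \<epsilon>"
  define A2 where "A2 = 16 * C2 * (1 + 2 * K) powr (1 + \<epsilon>) / \<epsilon>"
  define bnd where "bnd R = 64 * A1 * R powr (\<rho> - \<kappa>1 * m)
      + 64 * A2 * R powr (1 + (1 + \<rho>) * (\<kappa>2 * (1 + \<epsilon>) - 1))" for R
  have bnd_lim: "(bnd \<longlongrightarrow> 0) at_top"
  proof -
    have "((\<lambda>R. R powr (\<rho> - \<kappa>1 * m)) \<longlongrightarrow> 0) at_top"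
      "((\<lambda>R. R powr (1 + (1 + \<rho>) * (\<kappa>2 * (1 + \<epsilon>) - 1))) \<longlongrightarrow> 0) at_top"
      using exp1 exp2 by (auto intro!: tendsto_neg_powr filterlim_ident)
    thus ?thesis unfolding bnd_def by (intro tendsto_add_zero tendsto_mult_right_zero)
  qed
  have energy_nonneg: "energy s t \<ge> 0" for s t
    using a_pos[of "w s t"] g_pos[of "v s t"] by simp

  have local_bound: "integral (cbox (- N, - N) (N, N)) (\<lambda>(s, t). h' (w s t) * energy s t) \<le> bnd R"
    if R: "R \<ge> 1" "R \<ge> T" "R \<ge> N" and N: "N > 0" for N R
  proof -
    \<comment> \<open>This scaling makes the factors 2 in the growth regions fit the cutoff: |s| >=
      R and |t| <= 2 S give the condition of \<open>low\<close>, while |t| >= S and |s| <= 2 R give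
      that of \<open>up\<close>.\<close>
    define S where "S = R powr (1 + \<rho>)"
    have R_le_S: "R \<le> S"
      using R(1) \<rho>0 powr_mono[of 1 "1 + \<rho>" R] by (simp add: S_def)
    have S: "S \<ge> 1" "S \<ge> T" "S \<ge> N" "S > 0" using R R_le_S by auto
    define \<eta> where "\<eta> s t = \<psi> (s / R) * \<psi> (t / S)" for s t
    define \<eta>1 where "\<eta>1 s t = \<psi>' (s / R) / R * \<psi> (t / S)" for s t
    define \<eta>2 where "\<eta>2 s t = \<psi> (s / R) * (\<psi>' (t / S) / S)" for s t
    define Q where "Q = cbox (- (2 * R), - (2 * S)) (2 * R, 2 * S)"
    define F where "F s t = 4 * ((h (w s t))\<^sup>2 / h' (w s t)) *
       (a (w s t) * (\<eta>1 s t)\<^sup>2 + g (v s t) * (\<eta>2 s t)\<^sup>2)" for s t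
    have R_nz: "R \<noteq> 0" and S_nz: "S \<noteq> 0" using R S by auto
    have "integral Q (\<lambda>(s, t). (\<eta> s t)\<^sup>2 * (h' (w s t) * energy s t)) \<le> integral Q (\<lambda>(s, t). F s t)"
      unfolding Q_def F_def
    proof (rule caccioppoli[OF h(1,2,3)])
      show "((\<lambda>s. \<eta> s t) has_real_derivative \<eta>1 s t) (at s)" for s t
        unfolding \<eta>_def \<eta>1_def
        by (rule DERIV_cmult_right, rule DERIV_cong[OF DERIV_chain2[OF \<psi>(1)]])
           (use R_nz in \<open>auto intro!: derivative_eq_intros\<close>)
      show "((\<lambda>t. \<eta> s t) has_real_derivative \<eta>2 s t) (at t)" for s t
        unfolding \<eta>_def \<eta>2_def
        by (rule DERIV_cmult, rule DERIV_cong[OF DERIV_chain2[OF \<psi>(1)]])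
           (use S_nz in \<open>auto intro!: derivative_eq_intros\<close>)
      show "continuous_on UNIV (\<lambda>p. \<eta>1 (fst p) (snd p))" "continuous_on UNIV (\<lambda>p. \<eta>2 (fst p) (snd p))"
        unfolding \<eta>1_def \<eta>2_def using R_nz S_nz by (intro continuous_intros cont; simp)+
    qed (use R S in \<open>auto simp: \<eta>_def \<psi>(6)\<close>)
    also have "integral Q (\<lambda>(s, t). F s t)
        \<le> integral Q (\<lambda>p. 4 * (A1 * R powr (- (\<kappa>1 * m)) / R\<^sup>2 + A2 * S powr (\<kappa>2 * (1 + \<epsilon>)) / S\<^sup>2))"
    proof (rule integral_le)
      show "(\<lambda>(s, t). F s t) integrable_on Q"
        unfolding F_def Q_def \<eta>1_def \<eta>2_def split_beta
        by (intro integrable_continuous continuous_intros cont ballI less_imp_neq[symmetric] h(3) R_nz S_nz)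
           (use R_nz S_nz in auto)
      show "(\<lambda>p. 4 * (A1 * R powr (- (\<kappa>1 * m)) / R\<^sup>2 + A2 * S powr (\<kappa>2 * (1 + \<epsilon>)) / S\<^sup>2)) integrable_on Q"
        unfolding Q_def by (intro integrable_continuous continuous_intros)
    next
      fix p assume pQ: "p \<in> Q"
      obtain s t where p: "p = (s, t)" by (cases p)
      have st: "\<bar>s\<bar> \<le> 2 * R" "\<bar>t\<bar> \<le> 2 * S"
        using pQ by (auto simp: p Q_def)
      define W where "W = 1 + (w s t)\<^sup>2"
      have W: "W \<ge> 1" by (simp add: W_def)
      define H where "H = (h (w s t))\<^sup>2 / h' (w s t)"
      have H: "0 \<le> H" "H \<le> W powr ((1 + \<epsilon>) / 2) / \<epsilon>"
        using h(3)[of "w s t"] h(4)[of "w s t"] by (auto simp: H_def W_def)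
      \<comment> \<open>Where \<open>\<eta>1\<close> is nonzero, the lower bound makes |w| large,
        and the decay of \<open>a\<close> outweighs the growth of \<open>H\<close>.\<close>
      have "H * (a (w s t) * (\<eta>1 s t)\<^sup>2) \<le> A1 * R powr (- (\<kappa>1 * m)) / R\<^sup>2"
      proof (cases "\<eta>1 s t = 0")
        case True
        thus ?thesis using C \<epsilon> by (simp add: A1_def)
      next
        case False
        hence "1 \<le> \<bar>s / R\<bar>" using \<psi>(7)[of "s / R"] by (auto simp: \<eta>1_def)
        hence s: "R \<le> \<bar>s\<bar>" using R by (simp add: abs_div field_simps)
        have "S \<le> \<bar>s\<bar> powr (1 + \<rho>)"
          unfolding S_def using s R \<rho>0 by (intro powr_mono2) auto
        hence "c * \<bar>s\<bar> powr \<kappa>1 \<le> \<bar>w s t\<bar>" using low[of s t] s R st by linarith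
        moreover have "c * R powr \<kappa>1 \<le> c * \<bar>s\<bar> powr \<kappa>1"
          using s R c \<kappa> by (intro mult_left_mono powr_mono2) auto
        ultimately have "c * R powr \<kappa>1 \<le> \<bar>w s t\<bar>" by linarith
        hence "(c * R powr \<kappa>1)\<^sup>2 \<le> \<bar>w s t\<bar>\<^sup>2" using c by (intro power_mono) auto
        hence W_ge: "(c * R powr \<kappa>1)\<^sup>2 \<le> W" by (simp add: W_def)
        have pos: "c * R powr \<kappa>1 > 0" using c R by simp
        have "\<bar>\<eta>1 s t\<bar> \<le> 4 / R * 1"
          unfolding \<eta>1_def abs_mult using \<psi>(3,4)[of "t / S"] \<psi>(8)[of "s / R"] R
          by (intro mult_mono) (auto intro: divide_right_mono)
        hence "\<bar>\<eta>1 s t\<bar>\<^sup>2 \<le> (4 / R)\<^sup>2" by (intro power_mono) auto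
        hence \<eta>1: "(\<eta>1 s t)\<^sup>2 \<le> 16 / R\<^sup>2" by (simp add: power_divide)
        have "H * a (w s t) \<le> (W powr ((1 + \<epsilon>) / 2) / \<epsilon>) * (C1 * W powr (- \<mu> / 2))"
          using H a_le[of "w s t"] a_pos[of "w s t"] \<epsilon> by (intro mult_mono) (auto simp: W_def)
        also have "\<dots> = C1 / \<epsilon> * W powr ((1 + \<epsilon>) / 2 + (- \<mu> / 2))"
          by (simp only: powr_add) simp
        also have "(1 + \<epsilon>) / 2 + (- \<mu> / 2) = - m / 2" by (simp add: m_def field_simps)
        \<comment> \<open>The exponent is negative because \<open>m > 0\<close>, so the lower bound
          on \<open>W\<close> turns into an upper bound.\<close>
        also have "C1 / \<epsilon> * W powr (- m / 2) \<le> C1 / \<epsilon> * ((c * R powr \<kappa>1)\<^sup>2) powr (- m / 2)"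
          using W_ge pos m C \<epsilon> by (intro mult_left_mono powr_mono2') auto
        also have "((c * R powr \<kappa>1)\<^sup>2) powr (- m / 2) = (c * R powr \<kappa>1) powr (- m)"
          using pos by (simp add: powr_powr flip: powr_numeral)
        also have "\<dots> = c powr (- m) * R powr (- (\<kappa>1 * m))"
          using c by (simp add: powr_mult powr_powr)
        finally have "H * a (w s t) \<le> C1 / \<epsilon> * (c powr (- m) * R powr (- (\<kappa>1 * m)))" .
        hence "(H * a (w s t)) * (\<eta>1 s t)\<^sup>2 \<le> C1 / \<epsilon> * (c powr (- m) * R powr (- (\<kappa>1 * m))) * (16 / R\<^sup>2)"
          by (rule mult_mono) (use \<eta>1 C \<epsilon> in auto)
        thus ?thesis by (simp add: A1_def mult_ac)
      qed
      \<comment> \<open>Here \<open>g\<close> contributes only the constant \<open>C2\<close>; the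
        smallness comes from the slow growth of |w| compared with the factor
        \<open>1 / S\<^sup>2\<close>.\<close>
      moreover have "H * (g (v s t) * (\<eta>2 s t)\<^sup>2) \<le> A2 * S powr (\<kappa>2 * (1 + \<epsilon>)) / S\<^sup>2"
      proof (cases "\<eta>2 s t = 0")
        case True
        thus ?thesis using C \<epsilon> by (simp add: A2_def)
      next
        case False
        hence "1 \<le> \<bar>t / S\<bar>" using \<psi>(7)[of "t / S"] by (auto simp: \<eta>2_def)
        hence t: "S \<le> \<bar>t\<bar>" using S by (simp add: abs_div field_simps)
        have "R = S powr (1 / (1 + \<rho>))"
          using R \<rho>0 by (simp add: S_def powr_powr)
        also have "\<dots> \<le> \<bar>t\<bar> powr (1 / (1 + \<rho>))"
          using t S \<rho>0 by (intro powr_mono2) auto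
        finally have "\<bar>w s t\<bar> \<le> K * \<bar>t\<bar> powr \<kappa>2" using up[of t s] t S st by linarith
        also have "\<dots> \<le> K * (2 * S) powr \<kappa>2"
          using st K \<kappa> by (intro mult_left_mono powr_mono2) auto
        also have "\<dots> = K * (2 powr \<kappa>2 * S powr \<kappa>2)" using S by (simp add: powr_mult)
        also have "\<dots> \<le> K * (2 * S powr \<kappa>2)"
          using K \<kappa> powr_mono[of \<kappa>2 1 2] by (intro mult_left_mono mult_right_mono) auto
        finally have w_le: "\<bar>w s t\<bar> \<le> 2 * K * S powr \<kappa>2" by simp
        define Z where "Z = S powr \<kappa>2"
        have Z: "Z \<ge> 1" using S \<kappa> by (simp add: Z_def ge_one_powr_ge_zero)
        have "\<bar>w s t\<bar>\<^sup>2 \<le> (2 * K * Z)\<^sup>2" using w_le by (intro power_mono) (auto simp: Z_def)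
        hence "W \<le> 1 + (2 * K * Z)\<^sup>2" by (simp add: W_def)
        \<comment> \<open>The term \<open>4 * K * Z\<^sup>2\<close> completes the square, so that
          the power below acts on a single product.\<close>
        also have "\<dots> \<le> Z\<^sup>2 + (2 * K * Z)\<^sup>2 + 4 * K * Z\<^sup>2"
          using K one_le_power[OF Z, of 2] by (simp add: add_increasing2)
        also have "\<dots> = ((1 + 2 * K) * Z)\<^sup>2" by (simp add: power2_eq_square algebra_simps)
        finally have W_le: "W \<le> ((1 + 2 * K) * Z)\<^sup>2" .
        have pos: "(1 + 2 * K) * Z > 0" using K Z by simp
        have "\<bar>\<eta>2 s t\<bar> \<le> 1 * (4 / S)"
          unfolding \<eta>2_def abs_mult using \<psi>(3,4)[of "s / R"] \<psi>(8)[of "t / S"] S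
          by (intro mult_mono) (auto intro: divide_right_mono)
        hence "\<bar>\<eta>2 s t\<bar>\<^sup>2 \<le> (4 / S)\<^sup>2" by (intro power_mono) auto
        hence \<eta>2: "(\<eta>2 s t)\<^sup>2 \<le> 16 / S\<^sup>2" by (simp add: power_divide)
        have "W powr ((1 + \<epsilon>) / 2) \<le> (((1 + 2 * K) * Z)\<^sup>2) powr ((1 + \<epsilon>) / 2)"
          using W_le W \<epsilon> by (intro powr_mono2) auto
        also have "\<dots> = ((1 + 2 * K) * Z) powr (1 + \<epsilon>)"
          using pos by (simp add: powr_powr add_divide_distrib flip: powr_numeral)
        also have "\<dots> = (1 + 2 * K) powr (1 + \<epsilon>) * S powr (\<kappa>2 * (1 + \<epsilon>))"
          using K Z by (simp add: powr_mult powr_powr Z_def)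
        finally have "H \<le> (1 + 2 * K) powr (1 + \<epsilon>) * S powr (\<kappa>2 * (1 + \<epsilon>)) / \<epsilon>"
          using H(2) \<epsilon> by (meson divide_right_mono less_imp_le order_trans)
        hence "H * (g (v s t) * (\<eta>2 s t)\<^sup>2)
            \<le> (1 + 2 * K) powr (1 + \<epsilon>) * S powr (\<kappa>2 * (1 + \<epsilon>)) / \<epsilon> * (C2 * (16 / S\<^sup>2))"
          using g_le[of "v s t"] g_pos[of "v s t"] \<eta>2 C \<epsilon> H
          by (intro mult_mono) auto
        thus ?thesis by (simp add: A2_def mult_ac)
      qed
      ultimately show "(case p of (s, t) \<Rightarrow> F s t)
          \<le> 4 * (A1 * R powr (- (\<kappa>1 * m)) / R\<^sup>2 + A2 * S powr (\<kappa>2 * (1 + \<epsilon>)) / S\<^sup>2)"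
        unfolding p split F_def H_def[symmetric] by (simp only: distrib_left mult.assoc)
    qed
    also have "\<dots> = (4 * R) * (4 * S) * (4 * (A1 * R powr (- (\<kappa>1 * m)) / R\<^sup>2 + A2 * S powr (\<kappa>2 * (1 + \<epsilon>)) / S\<^sup>2))"
      using R S by (simp add: Q_def content_Pair)
    also have "\<dots> = bnd R"
    proof -
      have "S\<^sup>2 = S powr 2" using S by simp
      also have "\<dots> = R powr ((1 + \<rho>) * 2)" by (simp only: S_def powr_powr)
      finally have p2: "R\<^sup>2 = R powr 2" "S\<^sup>2 = R powr ((1 + \<rho>) * 2)" using R by simp_all
      have "R * S * R powr (- (\<kappa>1 * m)) / R\<^sup>2 = R powr 1 * R powr (1 + \<rho>) * R powr (- (\<kappa>1 * m)) / R powr 2"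
        unfolding p2 unfolding S_def using R by simp
      also have "\<dots> = R powr (1 + (1 + \<rho>) + (- (\<kappa>1 * m)) - 2)"
        by (simp only: powr_add powr_diff)
      also have "1 + (1 + \<rho>) + (- (\<kappa>1 * m)) - 2 = \<rho> - \<kappa>1 * m" by simp
      finally have 1: "R * S * R powr (- (\<kappa>1 * m)) / R\<^sup>2 = R powr (\<rho> - \<kappa>1 * m)" .
      have "R * S * S powr (\<kappa>2 * (1 + \<epsilon>)) / S\<^sup>2
          = R powr 1 * R powr (1 + \<rho>) * R powr ((1 + \<rho>) * (\<kappa>2 * (1 + \<epsilon>))) / R powr ((1 + \<rho>) * 2)"
        unfolding p2 unfolding S_def powr_powr using R by simp
      also have "\<dots> = R powr (1 + (1 + \<rho>) + (1 + \<rho>) * (\<kappa>2 * (1 + \<epsilon>)) - (1 + \<rho>) * 2)"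
        by (simp only: powr_add powr_diff)
      also have "1 + (1 + \<rho>) + (1 + \<rho>) * (\<kappa>2 * (1 + \<epsilon>)) - (1 + \<rho>) * 2
          = 1 + (1 + \<rho>) * (\<kappa>2 * (1 + \<epsilon>) - 1)" by (simp add: algebra_simps)
      finally have 2: "R * S * S powr (\<kappa>2 * (1 + \<epsilon>)) / S\<^sup>2 = R powr (1 + (1 + \<rho>) * (\<kappa>2 * (1 + \<epsilon>) - 1))" .
      have "(4 * R) * (4 * S) * (4 * (A1 * R powr (- (\<kappa>1 * m)) / R\<^sup>2 + A2 * S powr (\<kappa>2 * (1 + \<epsilon>)) / S\<^sup>2))
          = 64 * A1 * (R * S * R powr (- (\<kappa>1 * m)) / R\<^sup>2) + 64 * A2 * (R * S * S powr (\<kappa>2 * (1 + \<epsilon>)) / S\<^sup>2)"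
        by (simp add: distrib_left mult_ac)
      thus ?thesis unfolding 1 2 bnd_def .
    qed
    finally have *: "integral Q (\<lambda>(s, t). (\<eta> s t)\<^sup>2 * (h' (w s t) * energy s t)) \<le> bnd R" .
    have cont_L: "continuous_on X (\<lambda>(s, t). (\<eta> s t)\<^sup>2 * (h' (w s t) * energy s t))" for X
      unfolding \<eta>_def split_beta by (intro continuous_intros cont; use R_nz S_nz in simp)
    have \<eta>_1: "\<eta> s t = 1" if "\<bar>s\<bar> \<le> N" "\<bar>t\<bar> \<le> N" for s t
    proof -
      have "\<bar>s / R\<bar> \<le> 1" "\<bar>t / S\<bar> \<le> 1" using that R S by (auto simp: abs_div field_simps)
      thus ?thesis by (simp add: \<eta>_def \<psi>(5))
    qed
    have "integral (cbox (- N, - N) (N, N)) (\<lambda>(s, t). h' (w s t) * energy s t)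
        = integral (cbox (- N, - N) (N, N)) (\<lambda>(s, t). (\<eta> s t)\<^sup>2 * (h' (w s t) * energy s t))"
      by (rule integral_cong) (auto simp: \<eta>_1 abs_le_iff)
    \<comment> \<open>On the small box the cutoff equals 1, and the integrand is nonnegative on all
      of \<open>Q\<close>.\<close>
    also have "\<dots> \<le> integral Q (\<lambda>(s, t). (\<eta> s t)\<^sup>2 * (h' (w s t) * energy s t))"
    proof (rule integral_subset_le)
      show "cbox (- N, - N) (N, N) \<subseteq> Q" using R S by (auto simp: Q_def)
      show "(\<lambda>(s, t). (\<eta> s t)\<^sup>2 * (h' (w s t) * energy s t)) integrable_on cbox (- N, - N) (N, N)"
        "(\<lambda>(s, t). (\<eta> s t)\<^sup>2 * (h' (w s t) * energy s t)) integrable_on Q"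
        unfolding Q_def by (rule integrable_continuous[OF cont_L])+
      show "\<forall>p\<in>Q. 0 \<le> (case p of (s, t) \<Rightarrow> (\<eta> s t)\<^sup>2 * (h' (w s t) * energy s t))"
        using energy_nonneg h(3) by (auto simp: less_imp_le split: prod.split intro!: mult_nonneg_nonneg)
    qed
    finally show ?thesis using * by linarith
  qed

  \<comment> \<open>With \<open>N\<close> fixed, letting \<open>R\<close> tend to infinity gives a
    zero integral; a continuous nonnegative integrand then vanishes at each point of the box, and
    \<open>N\<close> is chosen so that the box contains \<open>(s, t)\<close>.\<close>
  have w1_0: "w1 s t = 0" for s t
  proof -
    define N where "N = \<bar>s\<bar> + \<bar>t\<bar> + 1"
    let ?L = "\<lambda>(s, t). h' (w s t) * energy s t"
    have N: "N > 0" by (simp add: N_def)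
    have nonneg: "0 \<le> ?L p" for p
      using energy_nonneg h(3) by (auto simp: less_imp_le split: prod.split intro!: mult_nonneg_nonneg)
    have cL: "continuous_on (cbox (- N, - N) (N, N)) ?L"
      unfolding split_beta by (intro continuous_intros cont)
    have "integral (cbox (- N, - N) (N, N)) ?L \<le> 0"
    proof (rule tendsto_lowerbound[OF bnd_lim])
      show "\<forall>\<^sub>F R in at_top. integral (cbox (- N, - N) (N, N)) ?L \<le> bnd R"
        using eventually_ge_at_top[of 1] eventually_ge_at_top[of T] eventually_ge_at_top[of N]
        by eventually_elim (rule local_bound[OF _ _ _ N])
    qed simp
    moreover have "integral (cbox (- N, - N) (N, N)) ?L \<ge> 0"
      using nonneg by (intro integral_nonneg integrable_continuous cL)
    ultimately have "integral (cbox (- N, - N) (N, N)) ?L = 0" by (rule antisym)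
    hence "(?L has_integral 0) (cbox (- N, - N) (N, N))"
      using integrable_integral[OF integrable_continuous[OF cL]] by (simp only:)
    moreover have "box (- N, - N) (N, N) \<noteq> {}"
    proof -
      have "(0, 0) \<in> box (- N, - N) (N, N)" using N by (auto simp: mem_box Basis_prod_def)
      thus ?thesis by blast
    qed
    moreover have "(s, t) \<in> cbox (- N, - N) (N, N)" by (auto simp: N_def)
    ultimately have "?L (s, t) = 0"
      using has_integral_0_cbox_imp_0[OF cL nonneg] by blast
    hence "energy s t = 0" using h(3)[of "w s t"] by simp
    hence "a (w s t) * (w1 s t)\<^sup>2 = 0"
      using a_pos[of "w s t"] g_pos[of "v s t"]
      by (smt (verit) mult_nonneg_nonneg zero_le_power2)
    thus ?thesis using a_pos[of "w s t"] by simp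
  qed
  have const: "w s 0 = w 0 0" for s
    using DERIV_isconst_all[of "\<lambda>s. w s 0" s 0] dw1[of 0] by (simp add: w1_0)
  \<comment> \<open>Solves \<open>c * B powr \<kappa>1 = |w 0 0| + 1\<close>; the added 1 makes the
    final contradiction strict.\<close>
  define B where "B = ((\<bar>w 0 0\<bar> + 1) / c) powr (1 / \<kappa>1)"
  define s where "s = max T (max 1 B)"
  have s: "T \<le> \<bar>s\<bar>" "0 < s" "B \<le> s" by (auto simp: s_def)
  have "(\<bar>w 0 0\<bar> + 1) / c = B powr \<kappa>1"
    using c \<kappa> by (simp add: B_def powr_powr)
  also have "\<dots> \<le> s powr \<kappa>1"
    using s(3) \<kappa> by (intro powr_mono2) (auto simp: B_def)
  finally have "\<bar>w 0 0\<bar> + 1 \<le> c * s powr \<kappa>1"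
    using c by (simp add: pos_divide_le_eq mult.commute)
  moreover have "c * s powr \<kappa>1 \<le> \<bar>w 0 0\<bar>"
    using low[of s 0] s const[of s] by simp
  ultimately show False by simp
qed

end

section \<open>Passage from filters and vectors to thresholds and pairs of reals\<close>

lemma eventually_going_to_at_top_within:
  fixes f :: "'a \<Rightarrow> real"
  shows "eventually P (f going_to at_top within A) \<longleftrightarrow> (\<exists>T. \<forall>x\<in>A. T \<le> f x \<longrightarrow> P x)"
  unfolding going_to_within_def eventually_inf_principal eventually_filtercomap_at_top_linorder
  by blast

definition coords :: "real \<Rightarrow> real \<Rightarrow> real ^ 2" where
  "coords s t = s *\<^sub>R axis 1 1 + t *\<^sub>R axis 2 1"

lemma coords_nth [simp]: "coords s t $ 1 = s" "coords s t $ 2 = t"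
  by (simp_all add: coords_def axis_def)

lemma coords_add_axis:
  "coords s t + r *\<^sub>R axis 1 1 = coords (s + r) t" "coords s t + r *\<^sub>R axis 2 1 = coords s (t + r)"
  by (simp_all add: coords_def algebra_simps)

lemma has_real_derivative_partial:
  assumes "has_partials u"
  shows "((\<lambda>t. u (x + t *\<^sub>R axis i 1)) has_real_derivative partial i u x) (at 0)"
  using assms unfolding has_partials_def partial_def by (simp add: DERIV_deriv_iff_real_differentiable)

lemma has_real_derivative_coords:
  assumes "has_partials u"
  shows "((\<lambda>s. u (coords s t)) has_real_derivative partial 1 u (coords s t)) (at s)"
    and "((\<lambda>t. u (coords s t)) has_real_derivative partial 2 u (coords s t)) (at t)"
  using has_real_derivative_partial[OF assms, of "coords s t" 1]
    has_real_derivative_partial[OF assms, of "coords s t" 2]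
    DERIV_shift[of "\<lambda>s. u (coords s t)" _ 0 s] DERIV_shift[of "\<lambda>t. u (coords s t)" _ 0 t]
  by (simp_all add: coords_add_axis add.commute)

lemma continuous_on_coords:
  assumes "continuous_on UNIV u"
  shows "continuous_on UNIV (\<lambda>p. u (coords (fst p) (snd p)))"
  unfolding coords_def by (intro continuous_on_compose2[OF assms] continuous_intros) auto

lemma C2_realD:
  assumes "C2_real f"
  shows "(f has_real_derivative deriv f t) (at t)"
    and "(deriv f has_real_derivative deriv (deriv f) t) (at t)"
    and "continuous_on UNIV (deriv (deriv f))"
  using assms unfolding C2_real_def by (simp_all add: DERIV_deriv_iff_real_differentiable)

lemma grad_split:
  fixes f :: "real ^ 2 \<Rightarrow> real"
  assumes "C2_real f1" "C2_real f2" and f: "\<And>p. f p = f1 (p $ 1) + f2 (p $ 2)"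
  shows "grad f p $ 1 = deriv f1 (p $ 1)" "grad f p $ 2 = deriv f2 (p $ 2)"
proof -
  have "((\<lambda>t. f1 (p $ 1 + t)) has_real_derivative deriv f1 (p $ 1)) (at 0)"
    "((\<lambda>t. f2 (p $ 2 + t)) has_real_derivative deriv f2 (p $ 2)) (at 0)"
    using C2_realD(1)[OF assms(1), of "p $ 1"] C2_realD(1)[OF assms(2), of "p $ 2"]
    by (simp_all add: DERIV_shift add.commute flip: DERIV_shift[of _ _ 0])
  hence "((\<lambda>t. f1 (p $ 1 + t) + f2 (p $ 2)) has_real_derivative deriv f1 (p $ 1)) (at 0)"
    "((\<lambda>t. f1 (p $ 1) + f2 (p $ 2 + t)) has_real_derivative deriv f2 (p $ 2)) (at 0)"
    by (auto intro!: derivative_eq_intros)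
  thus "grad f p $ 1 = deriv f1 (p $ 1)" "grad f p $ 2 = deriv f2 (p $ 2)"
    by (auto simp: grad_def partial_def f axis_def dest: DERIV_imp_deriv)
qed

text \<open>Each component of the flux depends on a single partial derivative of \<open>u\<close>,
  so the chain rule gives one term per direction. Both factors of each term are genuine derivatives
  because \<open>f1\<close>, \<open>f2\<close> and \<open>u\<close> are twice
  differentiable.\<close>

lemma divergence_split:
  fixes f u :: "real ^ 2 \<Rightarrow> real"
  assumes "C2_real f1" "C2_real f2" and f: "\<And>p. f p = f1 (p $ 1) + f2 (p $ 2)"
    and u: "C2_space u"
  shows "divergence (\<lambda>y. grad f (grad u y)) x
     = deriv (deriv f1) (partial 1 u x) * partial 1 (partial 1 u) x
     + deriv (deriv f2) (partial 2 u x) * partial 2 (partial 2 u) x"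
proof -
  have chain: "partial i (\<lambda>y. deriv \<phi> (partial i u y)) x
      = deriv (deriv \<phi>) (partial i u x) * partial i (partial i u) x" if "C2_real \<phi>" for i \<phi>
  proof -
    have "((\<lambda>t. deriv \<phi> (partial i u (x + t *\<^sub>R axis i 1))) has_real_derivative
        deriv (deriv \<phi>) (partial i u (x + 0 *\<^sub>R axis i 1)) * partial i (partial i u) x) (at 0)"
      by (rule DERIV_chain2[OF C2_realD(2)[OF that] has_real_derivative_partial])
         (use u in \<open>simp add: C2_space_def\<close>)
    thus ?thesis by (simp add: partial_def DERIV_imp_deriv)
  qed
  show ?thesis
    using chain[OF assms(1), of 1] chain[OF assms(2), of 2]
    by (simp add: divergence_def UNIV_2 grad_split[OF assms(1-3)] grad_def[of u])
qed

section \<open>From limit superior and limit inferior to pointwise growth bounds\<close>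

theorem theorem1p8:
  fixes f1 f2 :: "real \<Rightarrow> real" and f u :: "real ^ 2 \<Rightarrow> real"
    and C1 C2 \<mu>1 \<mu>2 \<kappa>1 \<kappa>2 \<rho> k :: real
  assumes "C2_real f1" and "C2_real f2"
    and "C1 > 0" and "C2 > 0" and "\<mu>1 > 1" and "\<mu>2 > 1"
    and "\<And>t. 0 < deriv (deriv f1) t \<and> deriv (deriv f1) t \<le> C1 * (1 + t\<^sup>2) powr (- \<mu>1 / 2)"
    and "\<And>t. 0 < deriv (deriv f2) t \<and> deriv (deriv f2) t \<le> C2 * (1 + t\<^sup>2) powr (- \<mu>2 / 2)"
    and "\<And>p. f p = f1 (p $ 1) + f2 (p $ 2)"
    and "C2_space u"
    and "\<And>x. divergence (\<lambda>y. grad f (grad u y)) x = 0"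
    and "\<kappa>1 > 0" and "0 \<le> \<kappa>2" and "\<kappa>2 < 1"
    and "\<mu>1 > 1 + (1 / \<kappa>1) * (\<kappa>2 / (1 - \<kappa>2))"
    and "\<kappa>2 / (1 - \<kappa>2) < \<rho>" and "\<rho> < \<kappa>1 * (\<mu>1 - 1)"
    and "k > 0"
    and "Limsup ((\<lambda>x. \<bar>x $ 2\<bar>) going_to at_top within M2 \<rho>)
           (\<lambda>x. ereal (\<bar>partial 1 u x\<bar> / \<bar>x $ 2\<bar> powr \<kappa>2)) \<le> ereal k"
  shows "Liminf ((\<lambda>x. \<bar>x $ 1\<bar>) going_to at_top within M1 \<rho>)
           (\<lambda>x. ereal (\<bar>partial 1 u x\<bar> / \<bar>x $ 1\<bar> powr \<kappa>1)) = 0"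
    (is "?L = 0")
proof (rule antisym)
  show "0 \<le> ?L"
    by (rule Liminf_bounded) simp
next
  have C2u: "has_partials u" "\<And>i. has_partials (partial i u)"
      "\<And>i. continuous_on UNIV (partial i u)" "\<And>i j. continuous_on UNIV (partial j (partial i u))"
    using assms(10) by (simp_all add: C2_space_def)
  interpret split_solution "deriv (deriv f1)" "deriv f2" "deriv (deriv f2)"
    "\<lambda>s t. partial 1 u (coords s t)" "\<lambda>s t. partial 1 (partial 1 u) (coords s t)"
    "\<lambda>s t. partial 2 (partial 1 u) (coords s t)"
    "\<lambda>s t. partial 2 u (coords s t)" "\<lambda>s t. partial 1 (partial 2 u) (coords s t)"
    "\<lambda>s t. partial 2 (partial 2 u) (coords s t)"
  proof
    show "partial 1 (partial 2 u) (coords s t) = partial 2 (partial 1 u) (coords s t)" for s t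
      by (rule mixed_partials_eq[symmetric, OF has_real_derivative_coords[OF C2u(1)]
            has_real_derivative_coords(2)[OF C2u(2)] has_real_derivative_coords(1)[OF C2u(2)]
            continuous_on_coords[OF C2u(3)] continuous_on_coords[OF C2u(4)]])
    show "deriv (deriv f1) (partial 1 u (coords s t)) * partial 1 (partial 1 u) (coords s t)
        + deriv (deriv f2) (partial 2 u (coords s t)) * partial 2 (partial 2 u) (coords s t) = 0" for s t
      using assms(11)[of "coords s t"] divergence_split[OF assms(1,2,9,10)] by simp
  qed (use assms(1,2,7,8) C2_realD C2u has_real_derivative_coords continuous_on_coords in blast)+
  show "?L \<le> 0"
  proof (rule ccontr)
    assume "\<not> ?L \<le> 0"
    \<comment> \<open>Density supplies a real \<open>c\<close> even if the limit inferior is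
      infinite.\<close>
    then obtain c where c: "0 < ereal c" "ereal c < ?L"
      using ereal_dense2[of 0 ?L] by (auto simp: not_le)
    from less_LiminfD[OF c(2)] obtain T1 where T1:
      "\<And>x. x \<in> M1 \<rho> \<Longrightarrow> T1 \<le> \<bar>x $ 1\<bar> \<Longrightarrow> c < \<bar>partial 1 u x\<bar> / \<bar>x $ 1\<bar> powr \<kappa>1"
      by (auto simp: eventually_going_to_at_top_within)
    \<comment> \<open>A limit superior of at most \<open>k\<close> bounds the quotient eventually
      only by constants larger than \<open>k\<close>.\<close>
    have "ereal k < ereal (k + 1)" by simp
    with assms(19) have "Limsup ((\<lambda>x. \<bar>x $ 2\<bar>) going_to at_top within M2 \<rho>)
           (\<lambda>x. ereal (\<bar>partial 1 u x\<bar> / \<bar>x $ 2\<bar> powr \<kappa>2)) < ereal (k + 1)"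
      by (rule le_less_trans)
    from Limsup_lessD[OF this] obtain T2 where T2:
      "\<And>x. x \<in> M2 \<rho> \<Longrightarrow> T2 \<le> \<bar>x $ 2\<bar> \<Longrightarrow> \<bar>partial 1 u x\<bar> / \<bar>x $ 2\<bar> powr \<kappa>2 < k + 1"
      by (auto simp: eventually_going_to_at_top_within)
    \<comment> \<open>The lower threshold 1 keeps the powers in the denominators positive, so the
      quotient bounds can be multiplied out.\<close>
    define T where "T = max 1 (max T1 T2)"
    show False
    proof (rule entire_growth_contradiction[where c = c and K = "k + 1" and T = T])
      show "deriv (deriv f1) y \<le> C1 * (1 + y\<^sup>2) powr (- \<mu>1 / 2)" for y
        using assms(7) by blast
      show "deriv (deriv f2) y \<le> C2" for y
      proof -
        have "(1 + y\<^sup>2) powr (- \<mu>2 / 2) \<le> (1 + y\<^sup>2) powr 0"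
          using assms(6) by (intro powr_mono) auto
        also have "\<dots> = 1" by (smt (verit) powr_zero_eq_one zero_le_power2)
        finally have "C2 * (1 + y\<^sup>2) powr (- \<mu>2 / 2) \<le> C2 * 1"
          using assms(4) by (intro mult_left_mono) auto
        thus ?thesis using assms(8)[of y] by linarith
      qed
      show "c * \<bar>s\<bar> powr \<kappa>1 \<le> \<bar>partial 1 u (coords s t)\<bar>"
        if "T \<le> \<bar>s\<bar>" "\<bar>t\<bar> \<le> 2 * \<bar>s\<bar> powr (1 + \<rho>)" for s t
      proof -
        have "c < \<bar>partial 1 u (coords s t)\<bar> / \<bar>s\<bar> powr \<kappa>1"
          using T1[of "coords s t"] that by (simp add: M1_def T_def)
        moreover have "\<bar>s\<bar> powr \<kappa>1 > 0" using that by (auto simp: T_def)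
        ultimately show ?thesis by (simp add: pos_less_divide_eq)
      qed
      show "\<bar>partial 1 u (coords s t)\<bar> \<le> (k + 1) * \<bar>t\<bar> powr \<kappa>2"
        if "T \<le> \<bar>t\<bar>" "\<bar>s\<bar> \<le> 2 * \<bar>t\<bar> powr (1 / (1 + \<rho>))" for s t
      proof -
        have "\<bar>partial 1 u (coords s t)\<bar> / \<bar>t\<bar> powr \<kappa>2 < k + 1"
          using T2[of "coords s t"] that by (simp add: M2_def T_def)
        moreover have "\<bar>t\<bar> powr \<kappa>2 > 0" using that by (auto simp: T_def)
        ultimately show ?thesis by (simp add: pos_divide_less_eq)
      qed
    qed (use assms c in auto)
  qed
qed

end
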